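(* Let $A$ be an $m \times n$ matrix with complex entries. If $A$ is a $(q,k,t)$-design matrix with $k \leq nt$, then $$\operatorname{rank}(A) \;\geq\; n - \frac{6mn^2t^3}{k^4}.$$
   Context: For a vector $v \in \mathbb{C}^N$, $\operatorname{supp}(v) = \{i : v_i \neq 0\}$. Let $A$ be an $m\times n$ matrix over $\mathbb{C}$ with rows $R_1,\dots,R_m \in \mathbb{C}^n$ and columns $C_1,\dots,C_n \in \mathbb{C}^m$. $A$ is a $(q,k,t)$-design matrix (with $q,k$ positive integers and $t$ a nonnegative integer) if: (1) $|\operatorname{supp}(R_i)| \le q$ for all $i \in [m]$; (2) $|\operatorname{supp}(C_j)| \ge k$ for all $j \in [n]$; (3) $|\operatorname{supp}(C_{j_1}) \cap \operatorname{supp}(C_{j_2})| \le t$ for all $j_1 \ne j_2 \in [n]$. *)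

theory Defs
  imports Complex_Main "Jordan_Normal_Form.DL_Rank"
begin

definition supp :: "'a::zero vec \<Rightarrow> nat set" where
  "supp v = {i. i < dim_vec v \<and> v $ i \<noteq> 0}"

text \<open>Rows and columns are indexed from 0.\<close>

definition design_matrix :: "nat \<Rightarrow> nat \<Rightarrow> nat \<Rightarrow> complex mat \<Rightarrow> bool" where
  "design_matrix q k t A \<longleftrightarrow>
     q > 0 \<and> k > 0 \<and>
     (\<forall>i < dim_row A. card (supp (row A i)) \<le> q) \<and>
     (\<forall>j < dim_col A. card (supp (col A j)) \<ge> k) \<and>
     (\<forall>j1 < dim_col A. \<forall>j2 < dim_col A. j1 \<noteq> j2 \<longrightarrow>
        card (supp (col A j1) \<inter> supp (col A j2)) \<le> t)"

end

(* For B = D A E with diagonal D, E and M = B^* B, rank A >= rank B >= (tr M)^2 / tr (M^2).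
   Pick k nonzero entries in each column of A and give each of them weight 1/k.  One can choose
   D and E so that the columns of B have norm 1 and its squared row norms are arbitrarily close
   to the row sums r_i of these weights.  Then M has unit diagonal, and since two columns share
   at most t nonzero positions, Cauchy-Schwarz bounds the off-diagonal part of tr (M^2) by
   t * sum r_i^2.  Counting pairs of columns gives sum r_i^2 <= 2 n^2 t / k^2, so the rank is at
   least n - 2 n^2 t^2 / k^2.  Cauchy-Schwarz applied to sum r_i = n gives k^2 <= 2 m t, which
   turns this into the claim. *)
theory Submission
  imports Defs "HOL-Analysis.Convex"
begin

lemma sq_sqrt_diff_le:
  fixes r s :: real
  assumes "r > 0" "s > 0"
  shows "(sqrt r - sqrt s)\<^sup>2 + r - s \<le> r * ln (r / s)"
proof -
  have "ln (sqrt s / sqrt r) \<le> sqrt s / sqrt r - 1"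
    using assms by (intro ln_le_minus_one) simp
  moreover have "ln (r / s) = - 2 * ln (sqrt s / sqrt r)"
    using assms by (simp add: ln_div ln_sqrt)
  ultimately have "r * (2 - 2 * (sqrt s / sqrt r)) \<le> r * ln (r / s)"
    using assms by (intro mult_left_mono) auto
  moreover have "(sqrt r - sqrt s)\<^sup>2 + r - s = r * (2 - 2 * (sqrt s / sqrt r))"
  proof -
    have "(sqrt r - sqrt s)\<^sup>2 + r - s = 2 * r - 2 * (sqrt r * sqrt s)"
      using assms by (simp add: power2_diff)
    also have "sqrt r * sqrt s = r * (sqrt s / sqrt r)"
      using assms by (simp add: field_simps)
    finally show ?thesis by (simp only: right_diff_distrib mult.left_commute mult.commute)
  qed
  ultimately show ?thesis by simp
qed

text \<open>The potential f below is bounded from below by Gibbs' inequality. Multiplying each x i by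
  r i over the current i-th row sum lowers it by at least the quantity to be made small, so any x
  with f x close enough to the infimum works.\<close>
lemma approx_scaling:
  fixes a w :: "'i \<Rightarrow> 'j \<Rightarrow> real"
  assumes fin: "finite I" "finite J"
    and a: "\<And>i j. i \<in> I \<Longrightarrow> j \<in> J \<Longrightarrow> a i j \<ge> 0"
    and w: "\<And>i j. i \<in> I \<Longrightarrow> j \<in> J \<Longrightarrow> w i j \<ge> 0"
    and wa: "\<And>i j. i \<in> I \<Longrightarrow> j \<in> J \<Longrightarrow> w i j > 0 \<Longrightarrow> a i j > 0"
    and col: "\<And>j. j \<in> J \<Longrightarrow> (\<Sum>i\<in>I. w i j) = 1"
    and row: "\<And>i. i \<in> I \<Longrightarrow> (\<Sum>j\<in>J. w i j) = r i"
    and r: "\<And>i. i \<in> I \<Longrightarrow> r i > 0"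
    and e: "e > 0"
  obtains x where "\<And>i. i \<in> I \<Longrightarrow> x i > 0"
    and "\<And>j. j \<in> J \<Longrightarrow> (\<Sum>i\<in>I. x i * a i j) > 0"
    and "(\<Sum>i\<in>I. (sqrt (r i) - sqrt (\<Sum>j\<in>J. x i * a i j / (\<Sum>k\<in>I. x k * a k j)))\<^sup>2) < e"
proof -
  define P where "P = {x. \<forall>i\<in>I. x i > (0::real)}"
  define cs where "cs x j = (\<Sum>i\<in>I. x i * a i j)" for x j
  define rs where "rs x i = (\<Sum>j\<in>J. x i * a i j / cs x j)" for x i
  define f where "f x = (\<Sum>j\<in>J. ln (cs x j)) - (\<Sum>i\<in>I. r i * ln (x i))" for x
  have cs_pos: "cs x j > 0" if "x \<in> P" "j \<in> J" for x j
  proof -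
    from col[OF that(2)] have "(\<Sum>i\<in>I. w i j) \<noteq> 0" by simp
    then obtain i where "i \<in> I" "w i j \<noteq> 0" by (meson sum.neutral)
    with w wa that have i: "i \<in> I" "a i j > 0" by (auto simp: order.strict_iff_order)
    show ?thesis unfolding cs_def
      using i that a by (intro sum_pos2[OF fin(1), of i]) (auto simp: P_def less_imp_le)
  qed
  have rs_pos: "rs x i > 0" if x: "x \<in> P" and i: "i \<in> I" for x i
  proof -
    from row[OF i] r[OF i] have "(\<Sum>j\<in>J. w i j) \<noteq> 0" by simp
    then obtain j where "j \<in> J" "w i j \<noteq> 0" by (meson sum.neutral)
    with w wa i have j: "j \<in> J" "a i j > 0" by (auto simp: order.strict_iff_order)
    show ?thesis unfolding rs_def
    proof (rule sum_pos2[OF fin(2) j(1)])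
      show "0 < x i * a i j / cs x j"
        using j i x cs_pos[OF x j(1)] by (simp add: P_def)
      show "0 \<le> x i * a i j' / cs x j'" if "j' \<in> J" for j'
        using that i x cs_pos[OF x that] a by (simp add: P_def less_imp_le)
    qed
  qed
  have sum_rs: "(\<Sum>i\<in>I. rs x i) = card J" if "x \<in> P" for x
  proof -
    have "(\<Sum>i\<in>I. rs x i) = (\<Sum>j\<in>J. \<Sum>i\<in>I. x i * a i j / cs x j)"
      unfolding rs_def by (rule sum.swap)
    also have "\<dots> = (\<Sum>j\<in>J. 1)"
    proof (rule sum.cong[OF refl])
      fix j assume "j \<in> J"
      then show "(\<Sum>i\<in>I. x i * a i j / cs x j) = 1"
        using cs_pos[OF that] unfolding sum_divide_distrib[symmetric]
        by (simp flip: cs_def) (metis less_irrefl)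
    qed
    finally show ?thesis by simp
  qed
  have sum_r: "(\<Sum>i\<in>I. r i) = card J"
  proof -
    have "(\<Sum>i\<in>I. r i) = (\<Sum>i\<in>I. \<Sum>j\<in>J. w i j)" using row by simp
    also have "\<dots> = (\<Sum>j\<in>J. \<Sum>i\<in>I. w i j)" by (rule sum.swap)
    finally show ?thesis using col by simp
  qed
  define K where "K = (\<Sum>j\<in>J. \<Sum>i\<in>I. w i j * ln (a i j / w i j))"
  have lower: "K \<le> f x" if x: "x \<in> P" for x
  proof -
    have "w i j * (ln (x i) + ln (a i j / w i j) - ln (cs x j)) \<le> x i * a i j / cs x j - w i j"
      if ij: "i \<in> I" "j \<in> J" for i j
    proof (cases "w i j = 0")
      case True
      then show ?thesis using ij x a cs_pos[OF x ij(2)] by (simp add: P_def less_imp_le)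
    next
      case False
      with w ij have w0: "w i j > 0" by (simp add: order.strict_iff_order)
      with wa ij have a0: "a i j > 0" by simp
      have x0: "x i > 0" using x ij by (simp add: P_def)
      note c0 = cs_pos[OF x ij(2)]
      have "ln (x i) + ln (a i j / w i j) - ln (cs x j) = ln (x i * a i j / (w i j * cs x j))"
        using w0 a0 x0 c0 by (simp add: ln_mult ln_div)
      also have "\<dots> \<le> x i * a i j / (w i j * cs x j) - 1"
        using w0 a0 x0 c0 by (intro ln_le_minus_one) simp
      finally have "w i j * (ln (x i) + ln (a i j / w i j) - ln (cs x j))
          \<le> w i j * (x i * a i j / (w i j * cs x j) - 1)"
        using w0 by (intro mult_left_mono) auto
      also have "\<dots> = x i * a i j / cs x j - w i j"
        using w0 c0 by (simp add: field_simps)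
      finally show ?thesis .
    qed
    then have "(\<Sum>i\<in>I. \<Sum>j\<in>J. w i j * (ln (x i) + ln (a i j / w i j) - ln (cs x j)))
        \<le> (\<Sum>i\<in>I. \<Sum>j\<in>J. x i * a i j / cs x j - w i j)"
      by (intro sum_mono) auto
    also have "\<dots> = 0"
      using sum_rs[OF x] sum_r row by (simp add: sum_subtractf rs_def)
    finally have "(\<Sum>i\<in>I. \<Sum>j\<in>J. w i j * ln (x i)) + (\<Sum>i\<in>I. \<Sum>j\<in>J. w i j * ln (a i j / w i j))
        \<le> (\<Sum>i\<in>I. \<Sum>j\<in>J. w i j * ln (cs x j))"
      by (simp add: algebra_simps sum.distrib sum_subtractf)
    moreover have "(\<Sum>i\<in>I. \<Sum>j\<in>J. w i j * ln (x i)) = (\<Sum>i\<in>I. r i * ln (x i))"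
      using row by (simp flip: sum_distrib_right)
    moreover have "(\<Sum>i\<in>I. \<Sum>j\<in>J. w i j * ln (cs x j)) = (\<Sum>j\<in>J. ln (cs x j))"
      using col by (subst sum.swap) (simp flip: sum_distrib_right)
    moreover have "(\<Sum>i\<in>I. \<Sum>j\<in>J. w i j * ln (a i j / w i j)) = K"
      unfolding K_def by (rule sum.swap)
    ultimately show ?thesis unfolding f_def by linarith
  qed
  have step: "\<exists>y\<in>P. f y \<le> f x - (\<Sum>i\<in>I. (sqrt (r i) - sqrt (rs x i))\<^sup>2)" if x: "x \<in> P" for x
  proof
    define y where "y i = x i * (r i / rs x i)" for i
    show y: "y \<in> P"
      using x r rs_pos[OF x] by (simp add: P_def y_def)
    have "(\<Sum>j\<in>J. ln (cs y j)) - (\<Sum>j\<in>J. ln (cs x j)) = (\<Sum>j\<in>J. ln (cs y j / cs x j))"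
      unfolding sum_subtractf[symmetric] using cs_pos[OF x] cs_pos[OF y]
      by (intro sum.cong refl ln_divide_pos[symmetric])
    also have "\<dots> \<le> (\<Sum>j\<in>J. cs y j / cs x j - 1)"
      using cs_pos[OF x] cs_pos[OF y] by (intro sum_mono ln_le_minus_one) simp
    also have "\<dots> = (\<Sum>j\<in>J. \<Sum>i\<in>I. r i / rs x i * (x i * a i j / cs x j)) - card J"
      unfolding cs_def[of y] y_def by (simp add: sum_subtractf sum_divide_distrib mult_ac)
    also have "(\<Sum>j\<in>J. \<Sum>i\<in>I. r i / rs x i * (x i * a i j / cs x j)) = (\<Sum>i\<in>I. r i / rs x i * rs x i)"
      unfolding rs_def[of x] sum_distrib_left by (rule sum.swap)
    also have "\<dots> = card J"
      using sum_r rs_pos[OF x] by (metis (no_types, lifting) less_irrefl nonzero_eq_divide_eq sum.cong)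
    finally have 1: "(\<Sum>j\<in>J. ln (cs y j)) \<le> (\<Sum>j\<in>J. ln (cs x j))" by simp
    have "(\<Sum>i\<in>I. r i * ln (y i)) = (\<Sum>i\<in>I. r i * ln (x i)) + (\<Sum>i\<in>I. r i * ln (r i / rs x i))"
      unfolding sum.distrib[symmetric]
    proof (rule sum.cong[OF refl])
      fix i assume i: "i \<in> I"
      with x r rs_pos[OF x i] have "x i > 0" "r i / rs x i > 0" by (auto simp: P_def)
      then have "ln (y i) = ln (x i) + ln (r i / rs x i)"
        unfolding y_def by (rule ln_mult_pos)
      then show "r i * ln (y i) = r i * ln (x i) + r i * ln (r i / rs x i)"
        by (simp add: distrib_left)
    qed
    moreover have "(\<Sum>i\<in>I. (sqrt (r i) - sqrt (rs x i))\<^sup>2 + r i - rs x i)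
        \<le> (\<Sum>i\<in>I. r i * ln (r i / rs x i))"
      using r rs_pos[OF x] by (intro sum_mono sq_sqrt_diff_le)
    moreover have "(\<Sum>i\<in>I. (sqrt (r i) - sqrt (rs x i))\<^sup>2 + r i - rs x i)
        = (\<Sum>i\<in>I. (sqrt (r i) - sqrt (rs x i))\<^sup>2)"
      using sum_r sum_rs[OF x] by (simp add: sum.distrib sum_subtractf)
    ultimately show "f y \<le> f x - (\<Sum>i\<in>I. (sqrt (r i) - sqrt (rs x i))\<^sup>2)"
      using 1 unfolding f_def by linarith
  qed
  have bdd: "bdd_below (f ` P)" by (rule bdd_belowI2[OF lower])
  have "(\<lambda>_. 1) \<in> P" by (simp add: P_def)
  then have "f ` P \<noteq> {}" by blast
  then obtain x where x: "x \<in> P" "f x < Inf (f ` P) + e"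
    using e cInf_lessD[of "f ` P" "Inf (f ` P) + e"] by auto
  from step[OF x(1)] obtain y where "y \<in> P"
    "f y \<le> f x - (\<Sum>i\<in>I. (sqrt (r i) - sqrt (rs x i))\<^sup>2)" by blast
  with cInf_lower[OF imageI[of y P f] bdd] x
  have "(\<Sum>i\<in>I. (sqrt (r i) - sqrt (rs x i))\<^sup>2) < e" by linarith
  with x(1) cs_pos[OF x(1)] show thesis
    by (intro that[of x]) (auto simp: P_def rs_def cs_def)
qed

text \<open>Gram-Schmidt in which linearly dependent vectors contribute zero vectors.\<close>
lemma orthonormal_factorization:
  fixes u :: "'l \<Rightarrow> 'i \<Rightarrow> complex"
  assumes "finite F" "finite I"
  obtains e c where
    "\<And>k l. k \<in> F \<Longrightarrow> l \<in> F \<Longrightarrow> k \<noteq> l \<Longrightarrow> (\<Sum>i\<in>I. cnj (e k i) * e l i) = 0"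
    "\<And>k. k \<in> F \<Longrightarrow> (\<Sum>i\<in>I. cnj (e k i) * e k i) = 1 \<or> (\<forall>i\<in>I. e k i = 0)"
    "\<And>l i. l \<in> F \<Longrightarrow> i \<in> I \<Longrightarrow> u l i = (\<Sum>k\<in>F. e k i * c k l)"
proof -
  let ?P = "\<lambda>F e c. (\<forall>k\<in>F. \<forall>l\<in>F. k \<noteq> l \<longrightarrow> (\<Sum>i\<in>I. cnj (e k i) * e l i) = 0) \<and>
      (\<forall>k\<in>F. (\<Sum>i\<in>I. cnj (e k i) * e k i) = 1 \<or> (\<forall>i\<in>I. e k i = 0)) \<and>
      (\<forall>l\<in>F. \<forall>i\<in>I. u l i = (\<Sum>k\<in>F. e k i * c k l))"
  have "\<exists>e c. ?P F e c"
    using assms(1)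
  proof (induction F rule: finite_induct)
    case empty
    show ?case by simp
  next
    case (insert p F)
    from insert.IH obtain e c where "?P F e c"
      by (elim exE)
    then have orth: "\<And>k l. k \<in> F \<Longrightarrow> l \<in> F \<Longrightarrow> k \<noteq> l \<Longrightarrow> (\<Sum>i\<in>I. cnj (e k i) * e l i) = 0"
      and unit: "\<And>k. k \<in> F \<Longrightarrow> (\<Sum>i\<in>I. cnj (e k i) * e k i) = 1 \<or> (\<forall>i\<in>I. e k i = 0)"
      and rep: "\<And>l i. l \<in> F \<Longrightarrow> i \<in> I \<Longrightarrow> u l i = (\<Sum>k\<in>F. e k i * c k l)"
      by blast+
    define d where "d k = (\<Sum>i\<in>I. cnj (e k i) * u p i)" for k
    define v where "v i = u p i - (\<Sum>k\<in>F. e k i * d k)" for i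
    define N where "N = sqrt (\<Sum>i\<in>I. (cmod (v i))\<^sup>2)"
    define z where "z i = v i / of_real N" for i
    have v_orth: "(\<Sum>i\<in>I. cnj (e k i) * v i) = 0" if k: "k \<in> F" for k
    proof -
      have "(\<Sum>i\<in>I. cnj (e k i) * v i) = d k - (\<Sum>i\<in>I. \<Sum>l\<in>F. cnj (e k i) * e l i * d l)"
        by (simp add: v_def d_def right_diff_distrib sum_subtractf sum_distrib_left mult.assoc)
      also have "(\<Sum>i\<in>I. \<Sum>l\<in>F. cnj (e k i) * e l i * d l)
          = (\<Sum>l\<in>F. (\<Sum>i\<in>I. cnj (e k i) * e l i) * d l)"
        by (subst sum.swap) (simp add: sum_distrib_right)
      also have "\<dots> = (\<Sum>l\<in>F. if l = k then (\<Sum>i\<in>I. cnj (e k i) * e k i) * d k else 0)"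
        using orth[OF k] by (intro sum.cong) auto
      also have "\<dots> = (\<Sum>i\<in>I. cnj (e k i) * e k i) * d k"
        using k insert.hyps by simp
      also have "\<dots> = d k"
        using unit[OF k] by (auto simp: d_def)
      finally show ?thesis by simp
    qed
    have zv: "v i = z i * of_real N" if "i \<in> I" for i
    proof (cases "N = 0")
      case True
      then have "(cmod (v i))\<^sup>2 = 0"
        using that assms(2) by (simp add: N_def sum_nonneg_eq_0_iff)
      then show ?thesis using True by simp
    next
      case False
      then show ?thesis by (simp add: z_def)
    qed
    have z_orth: "(\<Sum>i\<in>I. cnj (e k i) * z i) = 0" if "k \<in> F" for k
      using v_orth[OF that] unfolding z_def by (simp flip: sum_divide_distrib)
    have z_orth': "(\<Sum>i\<in>I. cnj (z i) * e k i) = 0" if "k \<in> F" for k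
    proof -
      have "(\<Sum>i\<in>I. cnj (z i) * e k i) = cnj (\<Sum>i\<in>I. cnj (e k i) * z i)"
        by (simp add: mult.commute)
      with z_orth[OF that] show ?thesis by simp
    qed
    have z_unit: "(\<Sum>i\<in>I. cnj (z i) * z i) = 1 \<or> (\<forall>i\<in>I. z i = 0)"
    proof (cases "N = 0")
      case True
      then show ?thesis by (simp add: z_def)
    next
      case False
      have "N\<^sup>2 = (\<Sum>i\<in>I. (cmod (v i))\<^sup>2)"
        unfolding N_def by (simp add: sum_nonneg)
      then have "(\<Sum>i\<in>I. cnj (v i) * v i) = of_real (N\<^sup>2)"
        by (simp only: of_real_sum complex_norm_square mult.commute)
      moreover have "(\<Sum>i\<in>I. cnj (z i) * z i) = (\<Sum>i\<in>I. cnj (v i) * v i) / of_real (N\<^sup>2)"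
        by (simp add: z_def sum_divide_distrib power2_eq_square)
      ultimately show ?thesis using False by simp
    qed
    let ?e = "e(p := z)"
    let ?c = "\<lambda>k l. if l = p then if k = p then of_real N else d k else if k = p then 0 else c k l"
    have p: "k \<noteq> p" if "k \<in> F" for k using that insert.hyps by auto
    show ?case
    proof (rule exI[of _ ?e], rule exI[of _ ?c], intro conjI ballI impI)
      fix k l assume "k \<in> insert p F" "l \<in> insert p F" "k \<noteq> l"
      then show "(\<Sum>i\<in>I. cnj (?e k i) * ?e l i) = 0"
        using orth z_orth z_orth' by auto
    next
      fix k assume "k \<in> insert p F"
      then show "(\<Sum>i\<in>I. cnj (?e k i) * ?e k i) = 1 \<or> (\<forall>i\<in>I. ?e k i = 0)"
        using unit z_unit by auto
    next
      fix l i assume l: "l \<in> insert p F" and i: "i \<in> I"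
      show "u l i = (\<Sum>k\<in>insert p F. ?e k i * ?c k l)"
      proof (cases "l = p")
        case True
        have "(\<Sum>k\<in>F. ?e k i * ?c k l) = (\<Sum>k\<in>F. e k i * d k)"
          using p True by (intro sum.cong) auto
        then show ?thesis
          using insert.hyps zv[OF i] True by (simp add: v_def algebra_simps)
      next
        case False
        have "(\<Sum>k\<in>F. ?e k i * ?c k l) = (\<Sum>k\<in>F. e k i * c k l)"
          using p False by (intro sum.cong) auto
        then show ?thesis
          using insert.hyps rep l i False by auto
      qed
    qed
  qed
  then obtain e c where "?P F e c" by (elim exE)
  then show ?thesis by (intro that[of e c]) blast+
qed

lemma frobenius_gram_commute:
  fixes d :: "'k \<Rightarrow> 'j \<Rightarrow> complex"
  shows "(\<Sum>j\<in>J. \<Sum>j'\<in>J. (cmod (\<Sum>k\<in>F. cnj (d k j) * d k j'))\<^sup>2)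
       = (\<Sum>k\<in>F. \<Sum>l\<in>F. (cmod (\<Sum>j\<in>J. cnj (d k j) * d l j))\<^sup>2)"
proof -
  have L: "of_real ((cmod (\<Sum>k\<in>F. cnj (d k j) * d k j'))\<^sup>2)
      = (\<Sum>k\<in>F. \<Sum>l\<in>F. cnj (d k j) * d k j' * d l j * cnj (d l j'))" for j j'
    unfolding complex_norm_square cnj_sum sum_product by (simp add: mult_ac)
  have R: "of_real ((cmod (\<Sum>j\<in>J. cnj (d k j) * d l j))\<^sup>2)
      = (\<Sum>j\<in>J. \<Sum>j'\<in>J. cnj (d k j) * d k j' * d l j * cnj (d l j'))" for k l
    unfolding complex_norm_square cnj_sum sum_product by (simp add: mult_ac)
  have "complex_of_real (\<Sum>j\<in>J. \<Sum>j'\<in>J. (cmod (\<Sum>k\<in>F. cnj (d k j) * d k j'))\<^sup>2)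
      = (\<Sum>j\<in>J. \<Sum>j'\<in>J. \<Sum>k\<in>F. \<Sum>l\<in>F. cnj (d k j) * d k j' * d l j * cnj (d l j'))"
    unfolding of_real_sum L ..
  also have "\<dots> = (\<Sum>j\<in>J. \<Sum>k\<in>F. \<Sum>l\<in>F. \<Sum>j'\<in>J. cnj (d k j) * d k j' * d l j * cnj (d l j'))"
    by (subst sum.swap) (simp add: sum.swap[of _ F J])
  also have "\<dots> = (\<Sum>k\<in>F. \<Sum>l\<in>F. \<Sum>j\<in>J. \<Sum>j'\<in>J. cnj (d k j) * d k j' * d l j * cnj (d l j'))"
    by (simp add: sum.swap[of _ F J])
  also have "\<dots> = complex_of_real (\<Sum>k\<in>F. \<Sum>l\<in>F. (cmod (\<Sum>j\<in>J. cnj (d k j) * d l j))\<^sup>2)"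
    unfolding of_real_sum R ..
  finally show ?thesis unfolding of_real_eq_iff .
qed

lemma trace_sq_le_card_mult_frobenius:
  fixes b :: "'i \<Rightarrow> 'j \<Rightarrow> complex"
  assumes fin: "finite F" "finite I"
    and b: "\<And>i j. i \<in> I \<Longrightarrow> j \<in> J \<Longrightarrow> b i j = (\<Sum>l\<in>F. u l i * v l j)"
  shows "(\<Sum>j\<in>J. \<Sum>i\<in>I. (cmod (b i j))\<^sup>2)\<^sup>2
    \<le> card F * (\<Sum>j\<in>J. \<Sum>j'\<in>J. (cmod (\<Sum>i\<in>I. cnj (b i j) * b i j'))\<^sup>2)"
proof -
  obtain e c where
    orth: "\<And>k l. k \<in> F \<Longrightarrow> l \<in> F \<Longrightarrow> k \<noteq> l \<Longrightarrow> (\<Sum>i\<in>I. cnj (e k i) * e l i) = 0"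
    and unit: "\<And>k. k \<in> F \<Longrightarrow> (\<Sum>i\<in>I. cnj (e k i) * e k i) = 1 \<or> (\<forall>i\<in>I. e k i = 0)"
    and rep: "\<And>l i. l \<in> F \<Longrightarrow> i \<in> I \<Longrightarrow> u l i = (\<Sum>k\<in>F. e k i * c k l)"
    by (rule orthonormal_factorization[OF fin, of u]) blast
  define d where "d k j = (if \<forall>i\<in>I. e k i = 0 then 0 else \<Sum>l\<in>F. c k l * v l j)" for k j
  have bd: "b i j = (\<Sum>k\<in>F. e k i * d k j)" if ij: "i \<in> I" "j \<in> J" for i j
  proof -
    have "b i j = (\<Sum>l\<in>F. \<Sum>k\<in>F. e k i * c k l * v l j)"
      using b[OF ij] rep ij by (simp add: sum_distrib_right)
    also have "\<dots> = (\<Sum>k\<in>F. e k i * (\<Sum>l\<in>F. c k l * v l j))"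
      by (subst sum.swap) (simp add: sum_distrib_left mult.assoc)
    also have "\<dots> = (\<Sum>k\<in>F. e k i * d k j)"
      using ij by (intro sum.cong) (auto simp: d_def)
    finally show ?thesis .
  qed
  have gram: "(\<Sum>i\<in>I. cnj (b i j) * b i j') = (\<Sum>k\<in>F. cnj (d k j) * d k j')"
    if j: "j \<in> J" "j' \<in> J" for j j'
  proof -
    have "(\<Sum>i\<in>I. cnj (b i j) * b i j')
        = (\<Sum>i\<in>I. (\<Sum>k\<in>F. cnj (e k i) * cnj (d k j)) * (\<Sum>l\<in>F. e l i * d l j'))"
      using bd j by simp
    also have "\<dots> = (\<Sum>i\<in>I. \<Sum>k\<in>F. \<Sum>l\<in>F. cnj (d k j) * d l j' * (cnj (e k i) * e l i))"
      unfolding sum_product by (simp add: mult_ac)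
    also have "\<dots> = (\<Sum>k\<in>F. \<Sum>l\<in>F. cnj (d k j) * d l j' * (\<Sum>i\<in>I. cnj (e k i) * e l i))"
      by (simp add: sum.swap[of _ F I] sum_distrib_left)
    also have "\<dots> = (\<Sum>k\<in>F. \<Sum>l\<in>F. if l = k then cnj (d k j) * d k j' else 0)"
    proof (intro sum.cong refl)
      fix k l assume kl: "k \<in> F" "l \<in> F"
      show "cnj (d k j) * d l j' * (\<Sum>i\<in>I. cnj (e k i) * e l i)
          = (if l = k then cnj (d k j) * d k j' else 0)"
      proof (cases "l = k")
        case True
        then show ?thesis using unit[OF kl(1)] by (auto simp: d_def)
      next
        case False
        then show ?thesis using orth[OF kl] by simp
      qed
    qed
    finally show ?thesis using fin by simp
  qed
  define g where "g k = (\<Sum>j\<in>J. (cmod (d k j))\<^sup>2)" for k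
  have "(\<Sum>i\<in>I. (cmod (b i j))\<^sup>2) = (\<Sum>k\<in>F. (cmod (d k j))\<^sup>2)" if "j \<in> J" for j
  proof -
    have "complex_of_real (\<Sum>i\<in>I. (cmod (b i j))\<^sup>2) = of_real (\<Sum>k\<in>F. (cmod (d k j))\<^sup>2)"
      using gram[OF that that] by (simp only: of_real_sum complex_norm_square mult.commute)
    then show ?thesis unfolding of_real_eq_iff .
  qed
  then have "(\<Sum>j\<in>J. \<Sum>i\<in>I. (cmod (b i j))\<^sup>2) = (\<Sum>k\<in>F. g k)"
    unfolding g_def by (subst sum.swap) simp
  then have "(\<Sum>j\<in>J. \<Sum>i\<in>I. (cmod (b i j))\<^sup>2)\<^sup>2 \<le> card F * (\<Sum>k\<in>F. (g k)\<^sup>2)"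
    using sum_squared_le_sum_of_squares[of g F] by (simp add: mult.commute)
  also have "(\<Sum>k\<in>F. (g k)\<^sup>2) \<le> (\<Sum>k\<in>F. \<Sum>l\<in>F. (cmod (\<Sum>j\<in>J. cnj (d k j) * d l j))\<^sup>2)"
  proof (rule sum_mono)
    fix k assume k: "k \<in> F"
    have "complex_of_real (g k) = (\<Sum>j\<in>J. cnj (d k j) * d k j)"
      unfolding g_def by (simp only: of_real_sum complex_norm_square mult.commute)
    then have "(g k)\<^sup>2 = (cmod (\<Sum>j\<in>J. cnj (d k j) * d k j))\<^sup>2"
      by (metis norm_of_real power2_abs)
    also have "\<dots> \<le> (\<Sum>l\<in>F. (cmod (\<Sum>j\<in>J. cnj (d k j) * d l j))\<^sup>2)"
      by (rule member_le_sum[OF k _ fin(1)]) simp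
    finally show "(g k)\<^sup>2 \<le> (\<Sum>l\<in>F. (cmod (\<Sum>j\<in>J. cnj (d k j) * d l j))\<^sup>2)" .
  qed
  also have "\<dots> = (\<Sum>j\<in>J. \<Sum>j'\<in>J. (cmod (\<Sum>k\<in>F. cnj (d k j) * d k j'))\<^sup>2)"
    by (rule frobenius_gram_commute[symmetric])
  also have "\<dots> = (\<Sum>j\<in>J. \<Sum>j'\<in>J. (cmod (\<Sum>i\<in>I. cnj (b i j) * b i j'))\<^sup>2)"
    using gram by simp
  finally show ?thesis by (simp add: mult_left_mono)
qed

lemma rank_factorization:
  fixes A :: "complex mat"
  assumes A: "A \<in> carrier_mat m n"
  obtains S c where "finite S" "card S = vec_space.rank m A"
    "\<And>i j. i < m \<Longrightarrow> j < n \<Longrightarrow> A $$ (i, j) = (\<Sum>s\<in>S. s $ i * c s j)"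
proof -
  interpret vec_space "TYPE(complex)" m .
  have cols: "set (cols A) \<subseteq> carrier_vec m" using A cols_dim by blast
  have "lin_indpt {}" by (rule finite_lin_indpt2) auto
  then obtain S where S: "finite S" "maximal S (\<lambda>T. T \<subseteq> set (cols A) \<and> lin_indpt T)"
    using maximal_exists_superset[of "set (cols A)" "\<lambda>T. T \<subseteq> set (cols A) \<and> lin_indpt T" "{}"]
    by auto
  then have SA: "S \<subseteq> set (cols A)" and indpt: "lin_indpt S" by (simp_all add: maximal_def)
  with cols have SV: "S \<subseteq> carrier_vec m" by blast
  have "\<exists>a. col A j = lincomb a S" if j: "j < n" for j
  proof -
    have cj: "col A j \<in> set (cols A)" using A j by (simp add: cols_def)
    have "col A j \<in> span S"
    proof (rule ccontr)
      assume ns: "col A j \<notin> span S"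
      then have nS: "col A j \<notin> S" using SV in_own_span[of S] by (meson subsetD)
      then have "lin_indpt (S \<union> {col A j})"
        using lin_dep_iff_in_span[of S "col A j"] SV indpt cj cols ns by (meson subsetD)
      moreover have "S \<union> {col A j} \<subseteq> set (cols A)" using SA cj by simp
      ultimately have "S \<union> {col A j} = S"
        using S(2) unfolding maximal_def by (metis Un_upper1)
      with nS show False by blast
    qed
    then show ?thesis using finite_span[OF S(1) SV] by blast
  qed
  then obtain c where c: "\<And>j. j < n \<Longrightarrow> col A j = lincomb (c j) S" by metis
  show thesis
  proof (rule that[OF S(1)])
    show "card S = rank A" using rank_card_indpt[OF A S(2)] by simp
    fix i j assume ij: "i < m" "j < n"
    then have "A $$ (i, j) = lincomb (c j) S $ i"
      using A c by (metis carrier_matD index_col)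
    also have "\<dots> = (\<Sum>s\<in>S. s $ i * c j s)"
      using lincomb_index[OF ij(1) SV] by (simp add: mult.commute)
    finally show "A $$ (i, j) = (\<Sum>s\<in>S. s $ i * c j s)" .
  qed
qed

lemma rank_ge_fractional_cover:
  fixes A :: "complex mat" and w :: "nat \<Rightarrow> nat \<Rightarrow> real"
  assumes A: "A \<in> carrier_mat m n"
    and t: "\<And>j j'. j < n \<Longrightarrow> j' < n \<Longrightarrow> j \<noteq> j' \<Longrightarrow>
      card (supp (col A j) \<inter> supp (col A j')) \<le> t"
    and w: "\<And>i j. i < m \<Longrightarrow> j < n \<Longrightarrow> w i j \<ge> 0"
    and wA: "\<And>i j. i < m \<Longrightarrow> j < n \<Longrightarrow> w i j > 0 \<Longrightarrow> A $$ (i, j) \<noteq> 0"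
    and col: "\<And>j. j < n \<Longrightarrow> (\<Sum>i<m. w i j) = 1"
  shows "(real n)\<^sup>2 \<le> vec_space.rank m A * (n + t * (\<Sum>i<m. (\<Sum>j<n. w i j)\<^sup>2))"
proof -
  define r where "r i = (\<Sum>j<n. w i j)" for i
  have r_nonneg: "r i \<ge> 0" if "i < m" for i
    unfolding r_def using w that by (intro sum_nonneg) auto
  \<comment> \<open>Rows of weight 0 are dropped: no positive rescaling attains row sum 0 on a nonzero row.\<close>
  define I where "I = {i. i < m \<and> r i > 0}"
  have I: "finite I" "I \<subseteq> {..<m}" by (auto simp: I_def)
  have r0: "r i = 0" if "i \<in> {..<m} - I" for i
    using that r_nonneg[of i] by (auto simp: I_def)
  have w0: "w i j = 0" if "i \<in> {..<m} - I" "j < n" for i j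
    using r0[OF that(1)] that w unfolding r_def by (subst (asm) sum_nonneg_eq_0_iff) auto
  obtain S c where S: "finite S" "card S = vec_space.rank m A"
    and fact: "\<And>i j. i < m \<Longrightarrow> j < n \<Longrightarrow> A $$ (i, j) = (\<Sum>s\<in>S. s $ i * c s j)"
    using rank_factorization[OF A] by blast
  define near where "near e \<rho> \<longleftrightarrow>
      (\<forall>i\<in>I. \<rho> i \<ge> 0) \<and> (\<Sum>i\<in>I. (sqrt (r i) - sqrt (\<rho> i))\<^sup>2) < e \<and>
      (real n)\<^sup>2 \<le> vec_space.rank m A * (n + t * (\<Sum>i\<in>I. (\<rho> i)\<^sup>2))" for e and \<rho> :: "nat \<Rightarrow> real"
  have approx: "\<exists>\<rho>. near e \<rho>" if e: "e > 0" for e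
  proof -
    let ?a = "\<lambda>i j. (cmod (A $$ (i, j)))\<^sup>2"
    obtain x where x: "\<And>i. i \<in> I \<Longrightarrow> x i > 0"
      and cs: "\<And>j. j \<in> {..<n} \<Longrightarrow> (\<Sum>i\<in>I. x i * ?a i j) > 0"
      and small: "(\<Sum>i\<in>I. (sqrt (r i) - sqrt (\<Sum>j\<in>{..<n}. x i * ?a i j / (\<Sum>k\<in>I. x k * ?a k j)))\<^sup>2) < e"
    proof (rule approx_scaling[of I "{..<n}" ?a w r e])
      show "(\<Sum>i\<in>I. w i j) = 1" if "j \<in> {..<n}" for j
      proof -
        have "(\<Sum>i\<in>I. w i j) = (\<Sum>i<m. w i j)"
          using I w0 that by (intro sum.mono_neutral_left) auto
        then show ?thesis using col that by simp
      qed
    qed (use I w wA e in \<open>auto simp: I_def r_def\<close>)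
    define cs where "cs j = (\<Sum>i\<in>I. x i * ?a i j)" for j
    have cs_pos: "cs j > 0" if "j < n" for j using cs that by (simp add: cs_def)
    define b where "b i j = of_real (sqrt (x i)) * A $$ (i, j) / of_real (sqrt (cs j))" for i j
    define p where "p i j = x i * ?a i j / cs j" for i j
    have p: "p i j = (cmod (b i j))\<^sup>2" if "i \<in> I" "j < n" for i j
      using x[OF that(1)] cs_pos[OF that(2)]
      by (simp add: p_def b_def norm_mult norm_divide power_mult_distrib power_divide)
    have p_col: "(\<Sum>i\<in>I. p i j) = 1" if "j < n" for j
      using cs_pos[OF that] unfolding p_def sum_divide_distrib[symmetric] by (simp flip: cs_def)
    have p_nonneg: "p i j \<ge> 0" if "i \<in> I" "j < n" for i j
      using p[OF that] by simp
    have b_fact: "b i j = (\<Sum>s\<in>S. (of_real (sqrt (x i)) * s $ i) * (c s j / of_real (sqrt (cs j))))"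
      if "i \<in> I" "j \<in> {..<n}" for i j
      using that I fact[of i j] by (auto simp: b_def sum_distrib_left sum_divide_distrib mult_ac)
    have "(\<Sum>j<n. \<Sum>i\<in>I. (cmod (b i j))\<^sup>2) = n"
      using p p_col by simp
    with trace_sq_le_card_mult_frobenius[OF S(1) I(1), of "{..<n}" b, OF b_fact] S(2)
    have "(real n)\<^sup>2 \<le> vec_space.rank m A
        * (\<Sum>j<n. \<Sum>j'<n. (cmod (\<Sum>i\<in>I. cnj (b i j) * b i j'))\<^sup>2)"
      by simp
    also have "(\<Sum>j<n. \<Sum>j'<n. (cmod (\<Sum>i\<in>I. cnj (b i j) * b i j'))\<^sup>2)
        \<le> (\<Sum>j<n. \<Sum>j'<n. (if j = j' then 1 else 0) + t * (\<Sum>i\<in>I. p i j * p i j'))"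
    proof (intro sum_mono)
      fix j j' assume j: "j \<in> {..<n}" "j' \<in> {..<n}"
      show "(cmod (\<Sum>i\<in>I. cnj (b i j) * b i j'))\<^sup>2
          \<le> (if j = j' then 1 else 0) + t * (\<Sum>i\<in>I. p i j * p i j')"
      proof (cases "j = j'")
        case True
        have "(\<Sum>i\<in>I. cnj (b i j) * b i j) = of_real (\<Sum>i\<in>I. p i j)"
          using p j unfolding of_real_sum
          by (intro sum.cong refl) (simp only: complex_norm_square mult.commute lessThan_iff)
        then have "(\<Sum>i\<in>I. cnj (b i j) * b i j) = 1"
          using p_col j by (simp only: lessThan_iff of_real_1)
        moreover have "0 \<le> t * (\<Sum>i\<in>I. p i j * p i j')"
          using p_nonneg j by (intro mult_nonneg_nonneg sum_nonneg) auto
        ultimately show ?thesis using True by simp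
      next
        case False
        define C where "C = I \<inter> (supp (col A j) \<inter> supp (col A j'))"
        have C: "finite C" "C \<subseteq> I" using I by (auto simp: C_def)
        have "card C \<le> card (supp (col A j) \<inter> supp (col A j'))"
          by (rule card_mono) (auto simp: C_def supp_def)
        also have "\<dots> \<le> t" using t j False by simp
        finally have card_C: "card C \<le> t" .
        have "(\<Sum>i\<in>I. cnj (b i j) * b i j') = (\<Sum>i\<in>C. cnj (b i j) * b i j')"
          using I A j by (intro sum.mono_neutral_right) (auto simp: C_def supp_def b_def)
        then have "cmod (\<Sum>i\<in>I. cnj (b i j) * b i j') \<le> (\<Sum>i\<in>C. cmod (b i j) * cmod (b i j'))"
          using norm_sum[of "\<lambda>i. cnj (b i j) * b i j'" C] by (simp add: norm_mult)
        then have "(cmod (\<Sum>i\<in>I. cnj (b i j) * b i j'))\<^sup>2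
            \<le> (\<Sum>i\<in>C. cmod (b i j) * cmod (b i j'))\<^sup>2"
          by (rule power_mono) simp
        also have "\<dots> \<le> (\<Sum>i\<in>C. (cmod (b i j) * cmod (b i j'))\<^sup>2) * card C"
          by (rule sum_squared_le_sum_of_squares)
        also have "(\<Sum>i\<in>C. (cmod (b i j) * cmod (b i j'))\<^sup>2) = (\<Sum>i\<in>C. p i j * p i j')"
          using p j C(2) by (intro sum.cong) (auto simp: power_mult_distrib)
        also have "\<dots> * card C \<le> (\<Sum>i\<in>I. p i j * p i j') * t"
          using card_C C I p_nonneg j
          by (intro mult_mono sum_mono2 sum_nonneg) auto
        finally show ?thesis using False by (simp add: mult.commute)
      qed
    qed
    also have "\<dots> = n + t * (\<Sum>j<n. \<Sum>j'<n. \<Sum>i\<in>I. p i j * p i j')"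
      by (simp add: sum.distrib sum_distrib_left)
    also have "(\<Sum>j<n. \<Sum>j'<n. \<Sum>i\<in>I. p i j * p i j') = (\<Sum>i\<in>I. (\<Sum>j<n. p i j)\<^sup>2)"
      by (simp add: sum.swap[of _ I] power2_eq_square sum_product)
    finally have "(real n)\<^sup>2 \<le> vec_space.rank m A * (n + t * (\<Sum>i\<in>I. (\<Sum>j<n. p i j)\<^sup>2))"
      by (simp add: mult_left_mono)
    moreover have "\<forall>i\<in>I. (\<Sum>j<n. p i j) \<ge> 0"
      using p_nonneg by (intro ballI sum_nonneg) simp
    moreover have "(\<Sum>i\<in>I. (sqrt (r i) - sqrt (\<Sum>j<n. p i j))\<^sup>2) < e"
      using small by (simp only: p_def cs_def)
    ultimately have "near e (\<lambda>i. \<Sum>j<n. p i j)" unfolding near_def by blast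
    then show ?thesis by blast
  qed
  have "\<exists>\<rho>. near (1 / Suc N) \<rho>" for N by (rule approx) simp
  then obtain \<rho> where near: "\<And>N. near (1 / Suc N) (\<rho> N)" by metis
  have \<rho>: "\<And>N i. i \<in> I \<Longrightarrow> \<rho> N i \<ge> 0"
    and close: "\<And>N. (\<Sum>i\<in>I. (sqrt (r i) - sqrt (\<rho> N i))\<^sup>2) < 1 / Suc N"
    and bound: "\<And>N. (real n)\<^sup>2 \<le> vec_space.rank m A * (n + t * (\<Sum>i\<in>I. (\<rho> N i)\<^sup>2))"
    using near unfolding near_def by blast+
  have lim: "(\<lambda>N. \<rho> N i) \<longlonglongrightarrow> r i" if i: "i \<in> I" for i
  proof -
    have "(\<lambda>N. (sqrt (r i) - sqrt (\<rho> N i))\<^sup>2) \<longlonglongrightarrow> 0"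
    proof (rule tendsto_sandwich[OF _ _ tendsto_const LIMSEQ_Suc[OF lim_1_over_n]])
      have "(sqrt (r i) - sqrt (\<rho> N i))\<^sup>2 \<le> 1 / Suc N" for N
        using member_le_sum[OF i, of "\<lambda>i. (sqrt (r i) - sqrt (\<rho> N i))\<^sup>2"] I close[of N] by simp
      then show "\<forall>\<^sub>F N in sequentially. (sqrt (r i) - sqrt (\<rho> N i))\<^sup>2 \<le> 1 / real (Suc N)"
        by simp
    qed simp
    then have "(\<lambda>N. sqrt (r i) - sqrt (\<rho> N i)) \<longlonglongrightarrow> 0"
      by simp
    then have "(\<lambda>N. (sqrt (r i) - (sqrt (r i) - sqrt (\<rho> N i)))\<^sup>2) \<longlonglongrightarrow> (sqrt (r i) - 0)\<^sup>2"
      by (intro tendsto_intros)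
    then show ?thesis using \<rho>[OF i] i by (simp add: I_def)
  qed
  have "(\<lambda>N. vec_space.rank m A * (n + t * (\<Sum>i\<in>I. (\<rho> N i)\<^sup>2)))
      \<longlonglongrightarrow> vec_space.rank m A * (n + t * (\<Sum>i\<in>I. (r i)\<^sup>2))"
    by (intro tendsto_intros lim)
  then have "(real n)\<^sup>2 \<le> vec_space.rank m A * (n + t * (\<Sum>i\<in>I. (r i)\<^sup>2))"
    by (rule LIMSEQ_le_const) (use bound in blast)
  also have "(\<Sum>i\<in>I. (r i)\<^sup>2) = (\<Sum>i<m. (r i)\<^sup>2)"
    using I r0 by (intro sum.mono_neutral_left) auto
  finally show ?thesis unfolding r_def .
qed

theorem theorem1p5:
  fixes A :: "complex mat" and m n q k t :: nat
  assumes "A \<in> carrier_mat m n"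
    and "design_matrix q k t A"
    and "k \<le> n * t"
  shows "real (vec_space.rank m A)
           \<ge> real n - 6 * real m * real n ^ 2 * real t ^ 3 / real k ^ 4"
proof -
  note A = assms(1)
  have k: "k > 0"
    and sup: "\<And>j. j < n \<Longrightarrow> card (supp (col A j)) \<ge> k"
    and t: "\<And>j j'. j < n \<Longrightarrow> j' < n \<Longrightarrow> j \<noteq> j' \<Longrightarrow>
      card (supp (col A j) \<inter> supp (col A j')) \<le> t"
    using assms unfolding design_matrix_def by auto
  from k assms(3) have n: "n > 0" by (cases n) auto
  have "\<exists>T \<subseteq> supp (col A j). card T = k" if "j < n" for j
    using obtain_subset_with_card_n[OF sup[OF that]] by metis
  then obtain T where T: "\<And>j. j < n \<Longrightarrow> T j \<subseteq> supp (col A j)"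
    and card_T: "\<And>j. j < n \<Longrightarrow> card (T j) = k" by metis
  have T_m: "T j \<subseteq> {..<m}" if "j < n" for j
    using T[OF that] A by (auto simp: supp_def)
  define w where "w i j = (if i \<in> T j then 1 / real k else 0)" for i j
  define Q where "Q = (\<Sum>i<m. (\<Sum>j<n. w i j)\<^sup>2)"
  have col: "(\<Sum>i<m. w i j) = 1" if "j < n" for j
  proof -
    have "(\<Sum>i<m. w i j) = card ({..<m} \<inter> T j) / k"
      by (simp add: w_def sum.If_cases)
    then show ?thesis using k card_T[OF that] T_m[OF that] by (simp add: Int_absorb1)
  qed
  have main: "(real n)\<^sup>2 \<le> vec_space.rank m A * (n + t * Q)"
    unfolding Q_def
  proof (rule rank_ge_fractional_cover[OF A t _ _ col])
    show "A $$ (i, j) \<noteq> 0" if "i < m" "j < n" "w i j > 0" for i j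
      using T[OF that(2)] A that by (auto simp: w_def supp_def split: if_splits)
  qed (auto simp: w_def)
  have "Q = (\<Sum>j<n. \<Sum>j'<n. \<Sum>i<m. w i j * w i j')"
    unfolding Q_def by (simp add: sum.swap[of _ "{..<m}"] power2_eq_square sum_product)
  also have "\<dots> \<le> (\<Sum>j<n. \<Sum>j'<n. (if j = j' then 1 / k else 0) + t / k\<^sup>2)"
  proof (intro sum_mono)
    fix j j' assume j: "j \<in> {..<n}" "j' \<in> {..<n}"
    have "(\<Sum>i<m. w i j * w i j') = (\<Sum>i<m. if i \<in> T j \<inter> T j' then 1 / (real k)\<^sup>2 else 0)"
      by (intro sum.cong) (auto simp: w_def power2_eq_square)
    also have "\<dots> = card ({..<m} \<inter> (T j \<inter> T j')) / (real k)\<^sup>2"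
      by (simp add: sum.If_cases Int_def)
    also have "{..<m} \<inter> (T j \<inter> T j') = T j \<inter> T j'" using T_m j by auto
    also have "card (T j \<inter> T j') / (real k)\<^sup>2 \<le> (if j = j' then 1 / k else 0) + t / (real k)\<^sup>2"
    proof (cases "j = j'")
      case True
      then show ?thesis using card_T j k by (simp add: power2_eq_square)
    next
      case False
      have "card (T j \<inter> T j') \<le> card (supp (col A j) \<inter> supp (col A j'))"
        using T j by (intro card_mono) (auto simp: supp_def)
      also have "\<dots> \<le> t" using t j False by simp
      finally show ?thesis using False by (simp add: divide_right_mono)
    qed
    finally show "(\<Sum>i<m. w i j * w i j') \<le> (if j = j' then 1 / k else 0) + t / k\<^sup>2"
      by simp
  qed
  also have "\<dots> = real n * real k / (real k)\<^sup>2 + (real n)\<^sup>2 * t / (real k)\<^sup>2"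
    using k by (simp add: sum.distrib power2_eq_square distrib_left)
  also have "real n * real k / (real k)\<^sup>2 \<le> (real n)\<^sup>2 * t / (real k)\<^sup>2"
  proof -
    have "real k \<le> real n * real t"
      using assms(3) by (simp flip: of_nat_mult)
    then have "real n * real k \<le> (real n)\<^sup>2 * real t"
      by (simp add: power2_eq_square mult.assoc mult_left_mono)
    then show ?thesis by (rule divide_right_mono) simp
  qed
  finally have Q: "Q \<le> 2 * (real n)\<^sup>2 * t / (real k)\<^sup>2" by (simp add: mult_ac)
  have "real n = (\<Sum>i<m. \<Sum>j<n. w i j)"
    using col by (subst sum.swap) simp
  then have "(real n)\<^sup>2 \<le> Q * m"
    using sum_squared_le_sum_of_squares[of "\<lambda>i. \<Sum>j<n. w i j" "{..<m}"] by (simp add: Q_def)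
  also have "\<dots> \<le> 2 * (real n)\<^sup>2 * t / (real k)\<^sup>2 * m"
    using Q by (rule mult_right_mono) simp
  finally have "(real n)\<^sup>2 * 1 \<le> (real n)\<^sup>2 * (2 * t * m / (real k)\<^sup>2)"
    by (simp add: mult_ac)
  then have "1 \<le> 2 * t * m / (real k)\<^sup>2"
    using n by (subst (asm) mult_le_cancel_left_pos) auto
  then have km: "(real k)\<^sup>2 \<le> 2 * t * m"
    using k by (simp add: field_simps)
  have "0 \<le> real t * m" by simp
  with km have km': "(real k)\<^sup>2 \<le> 3 * t * m" by linarith
  define E where "E = t * Q"
  have E0: "E \<ge> 0" by (simp add: E_def Q_def sum_nonneg)
  have "(real n - E) * (n + E) \<le> (real n)\<^sup>2"
    by (simp add: algebra_simps power2_eq_square)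
  also have "\<dots> \<le> vec_space.rank m A * (n + E)" using main by (simp add: E_def)
  finally have "real n - E \<le> vec_space.rank m A"
    using n E0 by (subst (asm) mult_le_cancel_right_pos) auto
  moreover have "E \<le> 6 * real m * real n ^ 2 * real t ^ 3 / real k ^ 4"
  proof -
    have "E \<le> t * (2 * (real n)\<^sup>2 * t / (real k)\<^sup>2)"
      unfolding E_def using Q by (rule mult_left_mono) simp
    also have "\<dots> = 2 * (real n)\<^sup>2 * (real t)\<^sup>2 * (real k)\<^sup>2 / real k ^ 4"
      using k by (simp add: field_simps power2_eq_square power4_eq_xxxx)
    also have "\<dots> \<le> 2 * (real n)\<^sup>2 * (real t)\<^sup>2 * (3 * t * m) / real k ^ 4"
      using km' by (intro divide_right_mono mult_left_mono) auto
    also have "\<dots> = 6 * real m * real n ^ 2 * real t ^ 3 / real k ^ 4"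
      by (simp add: power2_eq_square power3_eq_cube)
    finally show ?thesis .
  qed
  ultimately show ?thesis by simp
qed

end
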